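(* Let $R$ be a convex quadrilateral in the $xy$-plane which is not a trapezoid, and let $M_1, M_2$ be the unique pair of conjugate directions that belongs to all ellipses passing through the four vertices of $R$. Then there exists an ellipse which passes through the four vertices of $R$ and whose equal conjugate diameters possess the directional constants $M_1$ and $M_2$ (that is, it has a pair of conjugate diameters of equal length whose directions are $M_1$ and $M_2$).
   Context: Ellipses are nondegenerate and include circles. A trapezoid is a convex quadrilateral with at least one pair of parallel sides. A diameter of an ellipse is a chord through its center. A pair of conjugate diameters of an ellipse are two diameters such that each bisects all chords drawn parallel to the other. If $\theta_1,\theta_2$ are the angles which a pair of conjugate diameters make with the positive $x$-axis, then $\tan\theta_1,\tan\theta_2$ (with the value $\infty$ for a vertical diameter) are called a pair of conjugate directions, or directional constants, of the ellipse, and one says that this pair belongs to the ellipse. It is a known result of Steiner that, for $R$ as in the claim, there is exactly one pair of conjugate directions $M_1, M_2$ that belongs to every ellipse passing through the four vertices of $R$. Equal conjugate diameters of an ellipse are a pair of conjugate diameters having the same length. *)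

theory Defs
  imports "HOL-Analysis.Analysis"
begin

(* Standard equation with semi-axes a, b relative to an orthonormal frame u, v at the center c;
   a = b is allowed, so circles are included. *)
definition ellipse_with_center :: "(real^2) set \<Rightarrow> real^2 \<Rightarrow> bool" where
  "ellipse_with_center E c \<longleftrightarrow>
     (\<exists>u v a b. norm u = 1 \<and> norm v = 1 \<and> u \<bullet> v = 0 \<and> 0 < a \<and> 0 < b \<and>
        E = {c + x *\<^sub>R u + y *\<^sub>R v | x y. (x / a)\<^sup>2 + (y / b)\<^sup>2 = 1})"

definition is_ellipse :: "(real^2) set \<Rightarrow> bool" where
  "is_ellipse E \<longleftrightarrow> (\<exists>c. ellipse_with_center E c)"

(* Chords, diameters and sides are given by their two end points. The lines through p, q and
   through r, s are parallel in the wide sense: they may coincide. *)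
definition parallel :: "real^2 \<Rightarrow> real^2 \<Rightarrow> real^2 \<Rightarrow> real^2 \<Rightarrow> bool" where
  "parallel p q r s \<longleftrightarrow> p \<noteq> q \<and> r \<noteq> s \<and> (\<exists>k. q - p = k *\<^sub>R (s - r))"

definition chord :: "(real^2) set \<Rightarrow> real^2 \<Rightarrow> real^2 \<Rightarrow> bool" where
  "chord E p q \<longleftrightarrow> p \<in> E \<and> q \<in> E \<and> p \<noteq> q"

definition ellipse_diameter :: "(real^2) set \<Rightarrow> real^2 \<Rightarrow> real^2 \<Rightarrow> bool" where
  "ellipse_diameter E p q \<longleftrightarrow>
     chord E p q \<and> (\<exists>c. ellipse_with_center E c \<and> c \<in> closed_segment p q)"

definition bisects_chords_parallel_to ::
    "(real^2) set \<Rightarrow> real^2 \<Rightarrow> real^2 \<Rightarrow> real^2 \<Rightarrow> real^2 \<Rightarrow> bool" where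
  "bisects_chords_parallel_to E p q r s \<longleftrightarrow>
     (\<forall>x y. chord E x y \<and> parallel x y r s \<longrightarrow> midpoint x y \<in> closed_segment p q)"

definition conjugate_diameters ::
    "(real^2) set \<Rightarrow> real^2 \<Rightarrow> real^2 \<Rightarrow> real^2 \<Rightarrow> real^2 \<Rightarrow> bool" where
  "conjugate_diameters E p q r s \<longleftrightarrow>
     ellipse_diameter E p q \<and> ellipse_diameter E r s \<and>
     bisects_chords_parallel_to E p q r s \<and> bisects_chords_parallel_to E r s p q"

definition equal_conjugate_diameters ::
    "(real^2) set \<Rightarrow> real^2 \<Rightarrow> real^2 \<Rightarrow> real^2 \<Rightarrow> real^2 \<Rightarrow> bool" where
  "equal_conjugate_diameters E p q r s \<longleftrightarrow>
     conjugate_diameters E p q r s \<and> dist p q = dist r s"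

(* Needed because tan (pi / 2) = 0 in HOL. The value -\<infinity> never occurs. *)
definition ext_tan :: "real \<Rightarrow> ereal" where
  "ext_tan \<theta> = (if cos \<theta> = 0 then \<infinity> else ereal (tan \<theta>))"

(* \<theta> is an angle between the undirected line through p, q and the positive x-axis. *)
definition directional_constant :: "real^2 \<Rightarrow> real^2 \<Rightarrow> ereal \<Rightarrow> bool" where
  "directional_constant p q M \<longleftrightarrow>
     (\<exists>\<theta> t. t \<noteq> 0 \<and> q - p = t *\<^sub>R vector [cos \<theta>, sin \<theta>] \<and> M = ext_tan \<theta>)"

definition conjugate_directions :: "(real^2) set \<Rightarrow> ereal \<Rightarrow> ereal \<Rightarrow> bool" where
  "conjugate_directions E M1 M2 \<longleftrightarrow>
     (\<exists>p q r s. conjugate_diameters E p q r s \<and>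
        directional_constant p q M1 \<and> directional_constant r s M2)"

definition common_conjugate_directions :: "(real^2) set \<Rightarrow> ereal \<Rightarrow> ereal \<Rightarrow> bool" where
  "common_conjugate_directions V M1 M2 \<longleftrightarrow>
     (\<forall>E. is_ellipse E \<and> V \<subseteq> E \<longrightarrow> conjugate_directions E M1 M2)"

(* Uniqueness is that of the unordered pair, conjugacy being symmetric. *)
definition unique_common_conjugate_directions :: "(real^2) set \<Rightarrow> ereal \<Rightarrow> ereal \<Rightarrow> bool" where
  "unique_common_conjugate_directions V M1 M2 \<longleftrightarrow>
     common_conjugate_directions V M1 M2 \<and>
     (\<forall>N1 N2. common_conjugate_directions V N1 N2 \<longrightarrow> {N1, N2} = {M1, M2})"

(* Vertices in cyclic order. The line through each side misses the opposite side, i.e. the other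
   two vertices lie strictly on one side of it; this also excludes straight angles. *)
definition convex_quadrilateral :: "real^2 \<Rightarrow> real^2 \<Rightarrow> real^2 \<Rightarrow> real^2 \<Rightarrow> bool" where
  "convex_quadrilateral A B C D \<longleftrightarrow>
     distinct [A, B, C, D] \<and>
     closed_segment C D \<inter> affine hull {A, B} = {} \<and>
     closed_segment D A \<inter> affine hull {B, C} = {} \<and>
     closed_segment A B \<inter> affine hull {C, D} = {} \<and>
     closed_segment B C \<inter> affine hull {D, A} = {}"

definition trapezoid :: "real^2 \<Rightarrow> real^2 \<Rightarrow> real^2 \<Rightarrow> real^2 \<Rightarrow> bool" where
  "trapezoid A B C D \<longleftrightarrow>
     convex_quadrilateral A B C D \<and> (parallel A B C D \<or> parallel B C D A)"

end

theory Submission imports Defs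
begin

text \<open>
  Every ellipse is the image of the unit circle under an affine map, so it is the set of all
  \<open>c + x p + y q\<close> with \<open>x\<^sup>2 + y\<^sup>2 = 1\<close> for some centre \<open>c\<close> and linearly independent \<open>p\<close>, \<open>q\<close>.
  Two of its diameters are conjugate exactly when they come from perpendicular diameters of the
  circle. Conversely, every such image is an ellipse with the conjugate half-diameters \<open>p\<close>, \<open>q\<close>:
  rotating the frame of the circle by a suitable angle makes the half-diameters perpendicular
  (\<open>ellipse_with_center_affine_circle\<close>, \<open>conjugate_diameters_affine_circle\<close>).

  The diagonals of the quadrilateral meet in an inner point \<open>K\<close>. Choose \<open>u\<close> along \<open>AC\<close> and \<open>v\<close>
  along \<open>BD\<close> with lengths the geometric means of the two pieces into which \<open>K\<close> cuts the diagonal;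
  then \<open>A = K + a u\<close>, \<open>C = K - (1/a) u\<close>, \<open>B = K + b v\<close>, \<open>D = K - (1/b) v\<close> with \<open>a\<close>, \<open>b\<close> positive if
  \<open>u\<close> points towards \<open>A\<close> and \<open>v\<close> towards \<open>B\<close>. In the chart that makes an ellipse through the four vertices a circle, the power of \<open>K\<close> is \<open>- \<bar>u\<bar>\<^sup>2\<close>,
  computed along \<open>AC\<close>, and \<open>- \<bar>v\<bar>\<^sup>2\<close>, computed along \<open>BD\<close>. Hence \<open>u\<close> and \<open>v\<close> have equal length in
  this chart, so that \<open>u + v\<close> and \<open>u - v\<close> are perpendicular there: their directions belong to every
  ellipse through the vertices (\<open>ellipse_through_balanced_chords\<close>). By uniqueness they are \<open>M1\<close>
  and \<open>M2\<close> in some order.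

  Now take the chart in which the Euclidean unit vectors along \<open>u + v\<close> and \<open>u - v\<close> become
  orthonormal. In it \<open>u\<close> and \<open>v\<close> have equal length, so by the converse of the intersecting chords
  theorem the four vertices lie on a circle. In the original plane this circle is an ellipse whose
  half-diameters along \<open>u + v\<close> and \<open>u - v\<close> are conjugate and have the same Euclidean length
  (\<open>equal_radii_ellipse_through_balanced_chords\<close>).
\<close>

section \<open>Planar coordinates\<close>

definition cross2 :: "real^2 \<Rightarrow> real^2 \<Rightarrow> real" where
  "cross2 p q = p $ 1 * q $ 2 - p $ 2 * q $ 1"

lemma cross2_simps [simp]:
  "cross2 p p = 0"
  "cross2 (p + p') q = cross2 p q + cross2 p' q"
  "cross2 p (q + q') = cross2 p q + cross2 p q'"
  "cross2 (p - p') q = cross2 p q - cross2 p' q"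
  "cross2 p (q - q') = cross2 p q - cross2 p q'"
  "cross2 (- p) q = - cross2 p q"
  "cross2 (k *\<^sub>R p) q = k * cross2 p q"
  "cross2 p (k *\<^sub>R q) = k * cross2 p q"
  by (simp_all add: cross2_def algebra_simps)

lemma cross2_commute: "cross2 q p = - cross2 p q"
  by (simp add: cross2_def)

lemma cross2_nonzero_vectors:
  assumes "cross2 p q \<noteq> 0"
  shows "p \<noteq> 0" "q \<noteq> 0"
  using assms by (auto simp: cross2_def)

text \<open>
  Lagrange's identity \<open>(u \<times> v)\<^sup>2 + (u \<bullet> v)\<^sup>2 = \<bar>u\<bar>\<^sup>2 \<bar>v\<bar>\<^sup>2\<close>.
\<close>

lemma cross2_orthonormal_nonzero:
  assumes "norm u = 1" "norm v = 1" "u \<bullet> v = 0"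
  shows "cross2 u v \<noteq> 0"
proof -
  have "(cross2 u v)\<^sup>2 + (u \<bullet> v)\<^sup>2 = (u \<bullet> u) * (v \<bullet> v)"
    by (simp add: cross2_def inner_vec_def sum_2 power2_eq_square algebra_simps)
  then show ?thesis
    using assms by (auto simp: norm_eq_sqrt_inner)
qed

text \<open>
  Cramer's rule.
\<close>

lemma cross2_coordinates_exist:
  assumes "cross2 p q \<noteq> 0"
  obtains x y where "z = x *\<^sub>R p + y *\<^sub>R q"
proof -
  have "cross2 p q *\<^sub>R z = cross2 z q *\<^sub>R p + cross2 p z *\<^sub>R q"
    by (simp add: vec_eq_iff forall_2 cross2_def algebra_simps)
  then have "z = (1 / cross2 p q) *\<^sub>R (cross2 z q *\<^sub>R p + cross2 p z *\<^sub>R q)"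
    using assms by (metis divide_inverse_commute inverse_eq_divide mult.right_neutral
        scaleR_one scaleR_scaleR left_inverse)
  then show thesis
    using that[of "cross2 z q / cross2 p q" "cross2 p z / cross2 p q"]
    by (simp add: scaleR_add_right)
qed

lemma cross2_coordinates_unique:
  assumes "cross2 p q \<noteq> 0" "x *\<^sub>R p + y *\<^sub>R q = x' *\<^sub>R p + y' *\<^sub>R q"
  shows "x = x'" "y = y'"
proof -
  have "cross2 (x *\<^sub>R p + y *\<^sub>R q) q = cross2 (x' *\<^sub>R p + y' *\<^sub>R q) q"
    "cross2 p (x *\<^sub>R p + y *\<^sub>R q) = cross2 p (x' *\<^sub>R p + y' *\<^sub>R q)"
    using assms(2) by auto
  then show "x = x'" "y = y'"
    using assms(1) by simp_all
qed

section \<open>Ellipses as affine images of the unit circle\<close>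

definition affine_circle :: "real^2 \<Rightarrow> real^2 \<Rightarrow> real^2 \<Rightarrow> (real^2) set" where
  "affine_circle c p q = {c + x *\<^sub>R p + y *\<^sub>R q | x y. x\<^sup>2 + y\<^sup>2 = 1}"

lemma affine_circleI:
  assumes "z = c + x *\<^sub>R p + y *\<^sub>R q" "x\<^sup>2 + y\<^sup>2 = 1"
  shows "z \<in> affine_circle c p q"
  using assms by (auto simp: affine_circle_def)

lemma affine_circleE:
  assumes "z \<in> affine_circle c p q"
  obtains x y where "z = c + x *\<^sub>R p + y *\<^sub>R q" "x\<^sup>2 + y\<^sup>2 = 1"
  using assms by (auto simp: affine_circle_def)

lemma affine_circle_commute: "affine_circle c p q = affine_circle c q p"
  unfolding affine_circle_def
  by (rule set_eqI) (auto, (metis add.commute add.left_commute)+)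

text \<open>
  The new frame is the image of the old one under a reflection, which preserves the unit circle. A
  reflection serves better than a rotation here because it is its own inverse: the inclusion
  proved for arbitrary frames yields the opposite one when applied to the new frame.
\<close>

lemma affine_circle_reflect:
  assumes mn: "m\<^sup>2 + n\<^sup>2 = 1"
  shows "affine_circle c (m *\<^sub>R p + n *\<^sub>R q) (n *\<^sub>R p - m *\<^sub>R q) = affine_circle c p q"
proof -
  have sub: "affine_circle c (m *\<^sub>R p + n *\<^sub>R q) (n *\<^sub>R p - m *\<^sub>R q) \<subseteq> affine_circle c p q"
    for p q
  proof
    fix z assume "z \<in> affine_circle c (m *\<^sub>R p + n *\<^sub>R q) (n *\<^sub>R p - m *\<^sub>R q)"
    then obtain x y where z: "z = c + x *\<^sub>R (m *\<^sub>R p + n *\<^sub>R q) + y *\<^sub>R (n *\<^sub>R p - m *\<^sub>R q)"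
      and xy: "x\<^sup>2 + y\<^sup>2 = 1" by (rule affine_circleE)
    have "(x * m + y * n)\<^sup>2 + (x * n - y * m)\<^sup>2 = (m\<^sup>2 + n\<^sup>2) * (x\<^sup>2 + y\<^sup>2)"
      by (simp add: power2_eq_square algebra_simps)
    then show "z \<in> affine_circle c p q"
      using z mn xy
      by (intro affine_circleI[where x = "x * m + y * n" and y = "x * n - y * m"])
         (simp_all add: algebra_simps)
  qed
  let ?p = "m *\<^sub>R p + n *\<^sub>R q" and ?q = "n *\<^sub>R p - m *\<^sub>R q"
  have "m *\<^sub>R ?p + n *\<^sub>R ?q = (m\<^sup>2 + n\<^sup>2) *\<^sub>R p" "n *\<^sub>R ?p - m *\<^sub>R ?q = (m\<^sup>2 + n\<^sup>2) *\<^sub>R q"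
    by (simp_all add: power2_eq_square algebra_simps)
  then have "affine_circle c p q \<subseteq> affine_circle c ?p ?q"
    using sub[of ?p ?q] mn by simp
  then show ?thesis using sub by blast
qed

lemma orthogonal_affine_circle_is_ellipse:
  assumes "p \<noteq> 0" "q \<noteq> 0" "p \<bullet> q = 0"
  shows "ellipse_with_center (affine_circle c p q) c"
  unfolding ellipse_with_center_def
proof (intro exI conjI)
  show "norm (p /\<^sub>R norm p) = 1" "norm (q /\<^sub>R norm q) = 1" "0 < norm p" "0 < norm q"
    "(p /\<^sub>R norm p) \<bullet> (q /\<^sub>R norm q) = 0"
    using assms by simp_all
  show "affine_circle c p q = {c + x *\<^sub>R (p /\<^sub>R norm p) + y *\<^sub>R (q /\<^sub>R norm q) |x y.
      (x / norm p)\<^sup>2 + (y / norm q)\<^sup>2 = 1}" (is "_ = ?E")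
  proof
    show "affine_circle c p q \<subseteq> ?E"
    proof
      fix z assume "z \<in> affine_circle c p q"
      then obtain x y where "z = c + x *\<^sub>R p + y *\<^sub>R q" "x\<^sup>2 + y\<^sup>2 = 1" by (rule affine_circleE)
      then show "z \<in> ?E"
        using assms
        by (intro CollectI, rule_tac x = "x * norm p" in exI, rule_tac x = "y * norm q" in exI)
           (simp add: divide_inverse mult.assoc)
    qed
    show "?E \<subseteq> affine_circle c p q"
      by (force simp: divide_inverse intro: affine_circleI)
  qed
qed

text \<open>
  The principal axes come from the intermediate value theorem: turning the frame of the unit circle
  by a right angle exchanges the two half-diameters up to sign, so their inner product changes sign
  and vanishes for some angle in between.
\<close>

lemma ellipse_with_center_affine_circle:
  assumes pq: "cross2 p q \<noteq> 0"
  shows "ellipse_with_center (affine_circle c p q) c"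
proof -
  define f where "f t = (cos t *\<^sub>R p + sin t *\<^sub>R q) \<bullet> (sin t *\<^sub>R p - cos t *\<^sub>R q)" for t :: real
  have cont: "continuous_on {0..pi/2} f" "continuous_on {0..pi/2} (\<lambda>t. - f t)"
    unfolding f_def by (intro continuous_intros)+
  have ends: "f 0 = - (p \<bullet> q)" "f (pi/2) = p \<bullet> q"
    by (simp_all add: f_def inner_commute)
  have "\<exists>t. f t = 0"
  proof (cases "0 \<le> p \<bullet> q")
    case True
    then show ?thesis using IVT'[of f 0 0 "pi/2"] cont ends by auto
  next
    case False
    then show ?thesis using IVT'[of "\<lambda>t. - f t" 0 0 "pi/2"] cont ends by auto
  qed
  then obtain t where t: "f t = 0" by blast
  have cs: "(cos t)\<^sup>2 + (sin t)\<^sup>2 = 1" by simp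
  let ?p = "cos t *\<^sub>R p + sin t *\<^sub>R q" and ?q = "sin t *\<^sub>R p - cos t *\<^sub>R q"
  have "cross2 (m *\<^sub>R p + n *\<^sub>R q) (n *\<^sub>R p - m *\<^sub>R q) = - ((m\<^sup>2 + n\<^sup>2) * cross2 p q)" for m n
    by (simp add: cross2_commute[of q p] power2_eq_square algebra_simps)
  then have "cross2 ?p ?q = - cross2 p q" by (simp only: cs mult_1_left)
  then have "cross2 ?p ?q \<noteq> 0" using pq by (simp only: neg_equal_0_iff_equal not_False_eq_True)
  then have "ellipse_with_center (affine_circle c ?p ?q) c"
    using cross2_nonzero_vectors[of ?p ?q] t unfolding f_def
    by (intro orthogonal_affine_circle_is_ellipse) blast+
  then show ?thesis by (simp only: affine_circle_reflect[OF cs])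
qed

lemma ellipse_is_affine_circle:
  assumes "is_ellipse E"
  obtains c p q where "cross2 p q \<noteq> 0" "E = affine_circle c p q"
proof -
  obtain c u v a b where uv: "norm u = 1" "norm v = 1" "u \<bullet> v = 0" and ab: "0 < a" "0 < b"
    and E: "E = {c + x *\<^sub>R u + y *\<^sub>R v | x y. (x / a)\<^sup>2 + (y / b)\<^sup>2 = 1}"
    using assms unfolding is_ellipse_def ellipse_with_center_def by blast
  have "E = affine_circle c (a *\<^sub>R u) (b *\<^sub>R v)"
  proof
    show "E \<subseteq> affine_circle c (a *\<^sub>R u) (b *\<^sub>R v)"
    proof
      fix z assume "z \<in> E"
      then obtain x y where "z = c + x *\<^sub>R u + y *\<^sub>R v" "(x / a)\<^sup>2 + (y / b)\<^sup>2 = 1"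
        unfolding E by blast
      then show "z \<in> affine_circle c (a *\<^sub>R u) (b *\<^sub>R v)"
        using ab by (intro affine_circleI[where x = "x / a" and y = "y / b"]) simp_all
    qed
    show "affine_circle c (a *\<^sub>R u) (b *\<^sub>R v) \<subseteq> E"
    proof
      fix z assume "z \<in> affine_circle c (a *\<^sub>R u) (b *\<^sub>R v)"
      then obtain x y where "z = c + x *\<^sub>R (a *\<^sub>R u) + y *\<^sub>R (b *\<^sub>R v)" "x\<^sup>2 + y\<^sup>2 = 1"
        by (rule affine_circleE)
      then show "z \<in> E"
        unfolding E using ab
        by (intro CollectI, rule_tac x = "x * a" in exI, rule_tac x = "y * b" in exI) simp
    qed
  qed
  moreover have "cross2 (a *\<^sub>R u) (b *\<^sub>R v) \<noteq> 0"
    using cross2_orthonormal_nonzero[OF uv] ab by simp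
  ultimately show thesis using that by blast
qed

text \<open>
  Vectors with orthogonal coordinates in the frame \<open>p\<close>, \<open>q\<close> can be scaled so that their
  coordinates become orthonormal; with the right sign of the second factor, the change of frame is
  a reflection of the unit circle.
\<close>

lemma affine_circle_conjugate_radii:
  assumes pq: "cross2 p q \<noteq> 0" and d: "d \<noteq> 0" "d' \<noteq> 0"
    and coords: "d = m *\<^sub>R p + n *\<^sub>R q" "d' = m' *\<^sub>R p + n' *\<^sub>R q"
    and orth: "m * m' + n * n' = 0"
  obtains s t where "s \<noteq> 0" "t \<noteq> 0" "affine_circle c p q = affine_circle c (s *\<^sub>R d) (t *\<^sub>R d')"
proof -
  have mn: "(m, n) \<noteq> (0, 0)" "(m', n') \<noteq> (0, 0)"
    using d coords by auto
  define r where "r = sqrt (m\<^sup>2 + n\<^sup>2)"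
  have r2: "r\<^sup>2 = m\<^sup>2 + n\<^sup>2" by (simp add: r_def)
  have r0: "r \<noteq> 0" using mn(1) by (simp add: r_def add_nonneg_eq_0_iff)
  \<comment> \<open>Being orthogonal to \<open>(m, n)\<close>, the pair \<open>(m', n')\<close> is a multiple of \<open>(n, - m)\<close>.\<close>
  define k where "k = (m' * n - n' * m) / r\<^sup>2"
  have m': "m' = k * n"
  proof -
    have "m' * r\<^sup>2 = (m' * n - n' * m) * n + m * (m * m' + n * n')"
      unfolding r2 by (simp add: power2_eq_square algebra_simps)
    then show ?thesis using r0 orth by (simp add: k_def field_simps)
  qed
  have n': "n' = - k * m"
  proof -
    have "n' * r\<^sup>2 = - (m' * n - n' * m) * m + n * (m * m' + n * n')"
      unfolding r2 by (simp add: power2_eq_square algebra_simps)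
    then show ?thesis using r0 orth by (simp add: k_def field_simps)
  qed
  have k0: "k \<noteq> 0" using mn(2) m' n' by auto
  have "(m / r)\<^sup>2 + (n / r)\<^sup>2 = (m\<^sup>2 + n\<^sup>2) / r\<^sup>2"
    by (simp add: power_divide add_divide_distrib)
  also have "\<dots> = 1" using r0 by (simp flip: r2)
  finally have "(m / r)\<^sup>2 + (n / r)\<^sup>2 = 1" .
  from affine_circle_reflect[OF this, of c p q]
  have "affine_circle c p q = affine_circle c ((1 / r) *\<^sub>R d) ((1 / (k * r)) *\<^sub>R d')"
    using k0 by (simp add: coords m' n' scaleR_add_right scaleR_diff_right)
  then show thesis using that[of "1 / r" "1 / (k * r)"] r0 k0 by simp
qed

section \<open>Conjugate diameters and directional constants\<close>

text \<open>
  A chord parallel to \<open>q\<close> comes from a vertical chord of the unit circle, whose end points \<open>(x, y)\<close>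
  and \<open>(x, - y)\<close> have their midpoint on the horizontal diameter.
\<close>

lemma bisects_chords_affine_circle:
  assumes pq: "cross2 p q \<noteq> 0"
  shows "bisects_chords_parallel_to (affine_circle c p q) (c - p) (c + p) (c - q) (c + q)"
  unfolding bisects_chords_parallel_to_def
proof (intro allI impI)
  fix z w
  assume "chord (affine_circle c p q) z w \<and> parallel z w (c - q) (c + q)"
  then obtain k where z: "z \<in> affine_circle c p q" and w: "w \<in> affine_circle c p q"
    and "z \<noteq> w" and k: "w - z = k *\<^sub>R ((c + q) - (c - q))"
    unfolding chord_def parallel_def by blast
  obtain x y where zxy: "z = c + x *\<^sub>R p + y *\<^sub>R q" "x\<^sup>2 + y\<^sup>2 = 1"
    using z by (rule affine_circleE)
  obtain x' y' where wxy: "w = c + x' *\<^sub>R p + y' *\<^sub>R q" "x'\<^sup>2 + y'\<^sup>2 = 1"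
    using w by (rule affine_circleE)
  have "x' *\<^sub>R p + y' *\<^sub>R q = x *\<^sub>R p + (y + 2 * k) *\<^sub>R q"
    using k unfolding zxy wxy by (simp add: algebra_simps scaleR_2 flip: scaleR_scaleR)
  then have x: "x' = x"
    by (rule cross2_coordinates_unique[OF pq])
  have "y' \<noteq> y" using \<open>z \<noteq> w\<close> x zxy wxy by auto
  moreover have "y'\<^sup>2 = y\<^sup>2" using zxy(2) wxy(2) x by simp
  ultimately have "y' = - y" by (simp add: power2_eq_iff)
  then have mid: "midpoint z w = c + x *\<^sub>R p"
    by (simp add: zxy wxy x midpoint_def vec_eq_iff)
  have "x\<^sup>2 \<le> 1" using zxy(2) by (metis le_add_same_cancel1 zero_le_power2)
  then have "\<bar>x\<bar> \<le> 1" by (simp add: abs_square_le_1)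
  moreover have "c + x *\<^sub>R p = (1 - (1 + x) / 2) *\<^sub>R (c - p) + ((1 + x) / 2) *\<^sub>R (c + p)"
    by (simp add: vec_eq_iff field_simps)
  ultimately show "midpoint z w \<in> closed_segment (c - p) (c + p)"
    unfolding mid closed_segment_def by (intro CollectI exI[of _ "(1 + x) / 2"]) auto
qed

lemma ellipse_diameter_affine_circle:
  assumes pq: "cross2 p q \<noteq> 0"
  shows "ellipse_diameter (affine_circle c p q) (c - p) (c + p)"
proof -
  have "c - p \<in> affine_circle c p q" "c + p \<in> affine_circle c p q"
    by (rule affine_circleI[where x = "-1" and y = 0], simp_all)
       (rule affine_circleI[where x = 1 and y = 0], simp_all)
  moreover have "c - p \<noteq> c + p"
  proof
    assume "c - p = c + p"
    then have "p = 0" by (simp add: vec_eq_iff)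
    then show False using cross2_nonzero_vectors(1)[OF pq] by simp
  qed
  moreover have "midpoint (c - p) (c + p) = c"
    by (simp add: midpoint_def vec_eq_iff)
  then have "c \<in> closed_segment (c - p) (c + p)"
    by (metis midpoint_in_closed_segment)
  ultimately show ?thesis
    using ellipse_with_center_affine_circle[OF pq] unfolding ellipse_diameter_def chord_def by blast
qed

lemma conjugate_diameters_affine_circle:
  assumes pq: "cross2 p q \<noteq> 0"
  shows "conjugate_diameters (affine_circle c p q) (c - p) (c + p) (c - q) (c + q)"
proof -
  have qp: "cross2 q p \<noteq> 0" using pq by (simp add: cross2_commute[of q p])
  show ?thesis
    using ellipse_diameter_affine_circle[OF pq, of c] bisects_chords_affine_circle[OF pq, of c]
      ellipse_diameter_affine_circle[OF qp, of c] bisects_chords_affine_circle[OF qp, of c]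
    unfolding conjugate_diameters_def affine_circle_commute[of c q p] by blast
qed

lemma conjugate_diameters_commute:
  "conjugate_diameters E p q r s \<longleftrightarrow> conjugate_diameters E r s p q"
  by (auto simp: conjugate_diameters_def)

text \<open>
  The polar angle of \<open>d\<close> serves for all chords of direction \<open>d\<close>. The chords are given in the form
  in which diameters occur, with centre \<open>c\<close> and half-diameter \<open>k d\<close>.
\<close>

lemma directional_constant_exists:
  assumes "d \<noteq> 0"
  obtains M where "\<And>c k. k \<noteq> 0 \<Longrightarrow> directional_constant (c - k *\<^sub>R d) (c + k *\<^sub>R d) M"
proof -
  have "(d $ 1 / norm d)\<^sup>2 + (d $ 2 / norm d)\<^sup>2 = (d \<bullet> d) / (norm d)\<^sup>2"
    by (simp add: inner_vec_def sum_2 power2_eq_square add_divide_distrib)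
  then have "(d $ 1 / norm d)\<^sup>2 + (d $ 2 / norm d)\<^sup>2 = 1"
    using assms by (simp add: power2_norm_eq_inner)
  then obtain \<theta> where \<theta>: "d $ 1 / norm d = cos \<theta>" "d $ 2 / norm d = sin \<theta>"
    by (rule sincos_total_2pi)
  have d: "d = norm d *\<^sub>R vector [cos \<theta>, sin \<theta>]"
    using assms by (simp add: vec_eq_iff forall_2 flip: \<theta>)
  have "directional_constant (c - k *\<^sub>R d) (c + k *\<^sub>R d) (ext_tan \<theta>)" if "k \<noteq> 0" for c k
  proof -
    have "(c + k *\<^sub>R d) - (c - k *\<^sub>R d) = (2 * k) *\<^sub>R d"
      by (simp add: vec_eq_iff)
    also have "\<dots> = (2 * k * norm d) *\<^sub>R vector [cos \<theta>, sin \<theta>]"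
      by (subst d) (simp add: mult.assoc)
    finally show ?thesis
      unfolding directional_constant_def using that assms
      by (intro exI[of _ \<theta>] exI[of _ "2 * k * norm d"]) simp
  qed
  then show thesis by (rule that)
qed

section \<open>The diagonals of a convex quadrilateral\<close>

lemma cross2_zero_in_affine_hull:
  assumes "P \<noteq> Q" "cross2 (Q - P) (X - P) = 0"
  shows "X \<in> affine hull {P, Q}"
proof -
  define d where "d = Q - P"
  have d0: "d \<bullet> d \<noteq> 0" using assms(1) by (simp add: d_def)
  \<comment> \<open>Split \<open>X - P\<close> into its components along \<open>d\<close> and along the normal of \<open>d\<close>.\<close>
  have "(d \<bullet> d) *\<^sub>R (X - P) = (d \<bullet> (X - P)) *\<^sub>R d + cross2 d (X - P) *\<^sub>R vector [- (d $ 2), d $ 1]"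
    by (simp add: vec_eq_iff forall_2 inner_vec_def sum_2 cross2_def algebra_simps)
  then have "(d \<bullet> d) *\<^sub>R (X - P) = (d \<bullet> (X - P)) *\<^sub>R d"
    using assms(2) by (simp add: d_def)
  then have "X - P = (d \<bullet> (X - P) / (d \<bullet> d)) *\<^sub>R d"
    using d0 by (metis divide_inverse_commute scaleR_scaleR scaleR_one left_inverse)
  then obtain k where "X - P = k *\<^sub>R d" by blast
  then have "X = (1 - k) *\<^sub>R P + k *\<^sub>R Q"
    by (simp add: d_def algebra_simps)
  then show ?thesis
    unfolding affine_hull_2 by (intro CollectI exI[of _ "1 - k"] exI[of _ k]) simp
qed

text \<open>
  The signed area of the triangle \<open>PQZ\<close> is an affine function of \<open>Z\<close>. If its values at \<open>X\<close>
  and \<open>Y\<close> did not have the same strict sign, it would vanish somewhere on the segment.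
\<close>

lemma segment_misses_line_same_side:
  assumes PQ: "P \<noteq> Q" and miss: "closed_segment X Y \<inter> affine hull {P, Q} = {}"
  shows "cross2 (Q - P) (X - P) * cross2 (Q - P) (Y - P) > 0"
proof (rule ccontr)
  let ?f = "\<lambda>Z. cross2 (Q - P) (Z - P)"
  assume neg: "\<not> ?thesis"
  have "\<exists>t. 0 \<le> t \<and> t \<le> 1 \<and> (1 - t) * ?f X + t * ?f Y = 0"
  proof (cases "?f X = 0")
    case True
    then show ?thesis by (intro exI[of _ 0]) simp
  next
    case False
    define x y where "x = ?f X" and "y = ?f Y"
    have le: "x * y \<le> 0" and x0: "x \<noteq> 0" using neg False by (simp_all add: x_def y_def)
    have xy: "x \<noteq> y" using le x0 by (auto simp: mult_le_0_iff)
    have "(0 \<le> x \<and> y \<le> 0) \<or> (x \<le> 0 \<and> 0 \<le> y)" using le by (simp add: mult_le_0_iff)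
    then have "0 \<le> x / (x - y)" "x / (x - y) \<le> 1"
      using xy by (auto simp: divide_simps)
    moreover have "(1 - x / (x - y)) * x + x / (x - y) * y = 0"
      using xy by (simp add: field_simps)
    ultimately show ?thesis unfolding x_def y_def by blast
  qed
  then obtain t where t: "0 \<le> t" "t \<le> 1" and zero: "(1 - t) * ?f X + t * ?f Y = 0" by blast
  define Z where "Z = (1 - t) *\<^sub>R X + t *\<^sub>R Y"
  have "?f Z = (1 - t) * ?f X + t * ?f Y"
    by (simp add: Z_def cross2_def algebra_simps)
  then have "Z \<in> affine hull {P, Q}"
    using zero by (intro cross2_zero_in_affine_hull[OF PQ]) simp
  moreover have "Z \<in> closed_segment X Y"
    using t unfolding Z_def closed_segment_def by blast
  ultimately show False using miss by blast
qed

text \<open>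
  For positive \<open>x\<close>, \<open>y\<close>, the number \<open>k\<close> is their geometric mean, and \<open>a\<close> is the common ratio
  of the geometric progression \<open>x\<close>, \<open>k\<close>, \<open>y\<close>. Here \<open>x\<close> and \<open>y\<close> will be signed areas;
  negative ones occur for a quadrilateral with clockwise vertices.
\<close>

lemma positive_product_geometric_mean:
  fixes x y :: real
  assumes "x * y > 0"
  obtains a k where "a > 0" "k \<noteq> 0" "a * k = y" "k / a = x"
proof -
  define a where "a = sqrt (y / x)"
  have a: "a > 0" "a * a = y / x"
    using assms by (auto simp: a_def zero_less_divide_iff zero_less_mult_iff)
  have x: "x \<noteq> 0" using assms by auto
  show thesis
    using that[of a "a * x"] a x by (simp add: field_simps)
qed

text \<open>
  The doubled signed areas \<open>\<alpha>\<close>, \<open>\<beta>\<close>, \<open>\<gamma>\<close>, \<open>\<delta>\<close> of the triangles that arise by omitting one vertex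
  (\<open>A\<close>, \<open>B\<close>, \<open>C\<close>, \<open>D\<close>, respectively) all have the same sign by convexity. They are the coefficients
  of the affine dependence \<open>\<alpha> A + \<gamma> C = \<beta> B + \<delta> D\<close> with \<open>\<alpha> + \<gamma> = \<beta> + \<delta>\<close>, so both sides, divided by
  this sum, are the common point \<open>K\<close> of the diagonals. The freedom in the lengths of \<open>u\<close> and \<open>v\<close>
  is used to make the two coefficients on each diagonal reciprocal: the product of the two pieces
  of a diagonal then becomes the squared length of \<open>u\<close> or \<open>v\<close> in every chart.
\<close>

lemma convex_quadrilateral_diagonals:
  assumes "convex_quadrilateral A B C D"
  obtains K u v a b where "cross2 u v \<noteq> 0" "a > 0" "b > 0"
    "A = K + a *\<^sub>R u" "C = K - (1 / a) *\<^sub>R u" "B = K + b *\<^sub>R v" "D = K - (1 / b) *\<^sub>R v"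
proof -
  define \<alpha> where "\<alpha> = cross2 (C - B) (D - B)"
  define \<beta> where "\<beta> = cross2 (C - A) (D - A)"
  define \<gamma> where "\<gamma> = cross2 (B - A) (D - A)"
  define \<delta> where "\<delta> = cross2 (B - A) (C - A)"
  note area_defs = \<alpha>_def \<beta>_def \<gamma>_def \<delta>_def
  have "\<delta> * \<gamma> > 0" "\<alpha> * \<delta> > 0" "\<beta> * \<alpha> > 0"
  proof -
    have ne: "A \<noteq> B" "B \<noteq> C" "C \<noteq> D"
      and miss: "closed_segment C D \<inter> affine hull {A, B} = {}"
        "closed_segment D A \<inter> affine hull {B, C} = {}"
        "closed_segment A B \<inter> affine hull {C, D} = {}"
      using assms by (auto simp: convex_quadrilateral_def)
    show "\<delta> * \<gamma> > 0"
      using segment_misses_line_same_side[OF ne(1) miss(1)] by (simp only: area_defs)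
    have "cross2 (C - B) (A - B) = \<delta>" "cross2 (D - C) (A - C) = \<beta>" "cross2 (D - C) (B - C) = \<alpha>"
      by (simp_all add: area_defs cross2_def algebra_simps)
    then show "\<alpha> * \<delta> > 0" "\<beta> * \<alpha> > 0"
      using segment_misses_line_same_side[OF ne(2) miss(2)]
        segment_misses_line_same_side[OF ne(3) miss(3)] by (simp_all only: flip: \<alpha>_def)
  qed
  then have signs: "\<alpha> * \<gamma> > 0" "\<beta> * \<delta> > 0" and S0: "\<alpha> + \<gamma> \<noteq> 0"
    by (auto simp: zero_less_mult_iff)
  have sum: "\<beta> + \<delta> = \<alpha> + \<gamma>" by (simp add: area_defs cross2_def algebra_simps)
  have balance: "\<alpha> *\<^sub>R A + \<gamma> *\<^sub>R C = \<beta> *\<^sub>R B + \<delta> *\<^sub>R D"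
    by (simp add: area_defs vec_eq_iff forall_2 cross2_def algebra_simps)
  define S where "S = \<alpha> + \<gamma>"
  define K where "K = (1 / S) *\<^sub>R (\<alpha> *\<^sub>R A + \<gamma> *\<^sub>R C)"
  obtain a k where a: "a > 0" "k \<noteq> 0" "a * k = \<gamma>" "k / a = \<alpha>"
    using signs(1) by (rule positive_product_geometric_mean)
  obtain b l where b: "b > 0" "l \<noteq> 0" "b * l = \<delta>" "l / b = \<beta>"
    using signs(2) by (rule positive_product_geometric_mean)
  define u where "u = (k / S) *\<^sub>R (A - C)"
  define v where "v = (l / S) *\<^sub>R (B - D)"
  have SK: "S *\<^sub>R K = \<alpha> *\<^sub>R A + \<gamma> *\<^sub>R C" "S *\<^sub>R K = \<beta> *\<^sub>R B + \<delta> *\<^sub>R D"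
    using S0 balance by (simp_all add: K_def S_def)
  have cancel: "X = Y" if "S *\<^sub>R X = S *\<^sub>R Y" for X Y :: "real^2"
    using that S0 by (simp add: S_def)
  show thesis
  proof (rule that)
    show "a > 0" "b > 0" by fact+
    have "S *\<^sub>R (K + a *\<^sub>R u) = S *\<^sub>R K + \<gamma> *\<^sub>R (A - C)"
      using S0 by (simp add: u_def S_def scaleR_add_right flip: a(3))
    also have "\<dots> = S *\<^sub>R A" unfolding SK(1) by (simp add: S_def algebra_simps)
    finally show "A = K + a *\<^sub>R u" using cancel by metis
    have "S *\<^sub>R (K - (1 / a) *\<^sub>R u) = S *\<^sub>R K - \<alpha> *\<^sub>R (A - C)"
      using S0 by (simp add: u_def S_def scaleR_diff_right flip: a(4))
    also have "\<dots> = S *\<^sub>R C" unfolding SK(1) by (simp add: S_def algebra_simps)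
    finally show "C = K - (1 / a) *\<^sub>R u" using cancel by metis
    have "S *\<^sub>R (K + b *\<^sub>R v) = S *\<^sub>R K + \<delta> *\<^sub>R (B - D)"
      using S0 by (simp add: v_def S_def scaleR_add_right flip: b(3))
    also have "\<dots> = S *\<^sub>R B" unfolding SK(2) by (simp add: S_def sum[symmetric] algebra_simps)
    finally show "B = K + b *\<^sub>R v" using cancel by metis
    have "S *\<^sub>R (K - (1 / b) *\<^sub>R v) = S *\<^sub>R K - \<beta> *\<^sub>R (B - D)"
      using S0 by (simp add: v_def S_def scaleR_diff_right flip: b(4))
    also have "\<dots> = S *\<^sub>R D" unfolding SK(2) by (simp add: S_def sum[symmetric] algebra_simps)
    finally show "D = K - (1 / b) *\<^sub>R v" using cancel by metis
    have "cross2 (A - C) (B - D) = S"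
      by (simp add: S_def area_defs cross2_def algebra_simps)
    then show "cross2 u v \<noteq> 0" using S0 a(2) b(2)
      unfolding u_def v_def cross2_simps(7,8) by (simp add: S_def)
  qed
qed

section \<open>Ellipses through the four vertices\<close>

text \<open>
  The power of the point \<open>(o1, o2)\<close> with respect to the unit circle is minus the product of the
  segments \<open>a \<bar>u\<bar>\<close> and \<open>(1/a) \<bar>u\<bar>\<close> of a chord through it. The right-hand side depends only on the
  point; comparing it for two chords shows that their vectors \<open>u\<close> have equal length.
\<close>

lemma power_of_point_balanced_chord:
  fixes a o1 o2 u1 u2 :: real
  assumes a: "a > 0"
    and "(o1 + a * u1)\<^sup>2 + (o2 + a * u2)\<^sup>2 = 1"
    and "(o1 - (1 / a) * u1)\<^sup>2 + (o2 - (1 / a) * u2)\<^sup>2 = 1"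
  shows "u1\<^sup>2 + u2\<^sup>2 = 1 - (o1\<^sup>2 + o2\<^sup>2)"
proof -
  have 1: "(o1\<^sup>2 + o2\<^sup>2) + 2 * a * (o1 * u1 + o2 * u2) + a\<^sup>2 * (u1\<^sup>2 + u2\<^sup>2) = 1"
    using assms(2) by (simp add: power2_eq_square algebra_simps)
  have "a * (o1 - (1 / a) * u1) = a * o1 - u1" "a * (o2 - (1 / a) * u2) = a * o2 - u2"
    using a by (simp_all add: right_diff_distrib)
  then have "(a * o1 - u1)\<^sup>2 + (a * o2 - u2)\<^sup>2
      = a\<^sup>2 * ((o1 - (1 / a) * u1)\<^sup>2 + (o2 - (1 / a) * u2)\<^sup>2)"
    by (metis distrib_left power_mult_distrib)
  then have "(a * o1 - u1)\<^sup>2 + (a * o2 - u2)\<^sup>2 = a\<^sup>2"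
    by (simp only: assms(3) mult_1_right)
  then have 2: "a\<^sup>2 * (o1\<^sup>2 + o2\<^sup>2) - 2 * a * (o1 * u1 + o2 * u2) + (u1\<^sup>2 + u2\<^sup>2) = a\<^sup>2"
    by (simp add: power2_eq_square algebra_simps)
  have "(1 + a\<^sup>2) * (u1\<^sup>2 + u2\<^sup>2) = (1 + a\<^sup>2) * (1 - (o1\<^sup>2 + o2\<^sup>2))"
    using 1 2 by (simp add: algebra_simps)
  moreover have "1 + a\<^sup>2 \<noteq> 0" by (metis add_pos_nonneg zero_less_one zero_le_power2 less_irrefl)
  ultimately show ?thesis by simp
qed

text \<open>
  By the power of \<open>K\<close>, the coordinate vectors of \<open>u\<close> and \<open>v\<close> in the frame of the ellipse have equal
  length. So \<open>u + v\<close> and \<open>u - v\<close> have orthogonal coordinates, being the diagonals of a rhombus.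
\<close>

lemma ellipse_through_balanced_chords:
  assumes E: "is_ellipse E" and uv: "cross2 u v \<noteq> 0" and ab: "a > 0" "b > 0"
    and sub: "{K + a *\<^sub>R u, K + b *\<^sub>R v, K - (1 / a) *\<^sub>R u, K - (1 / b) *\<^sub>R v} \<subseteq> E"
  obtains c s t where "s \<noteq> 0" "t \<noteq> 0" "E = affine_circle c (s *\<^sub>R (u + v)) (t *\<^sub>R (u - v))"
proof -
  obtain c p q where pq: "cross2 p q \<noteq> 0" and Epq: "E = affine_circle c p q"
    using E by (rule ellipse_is_affine_circle)
  obtain u1 u2 where u: "u = u1 *\<^sub>R p + u2 *\<^sub>R q" using pq by (rule cross2_coordinates_exist)
  obtain v1 v2 where v: "v = v1 *\<^sub>R p + v2 *\<^sub>R q" using pq by (rule cross2_coordinates_exist)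
  obtain o1 o2 where o: "K - c = o1 *\<^sub>R p + o2 *\<^sub>R q" using pq by (rule cross2_coordinates_exist)
  have unit: "x\<^sup>2 + y\<^sup>2 = 1" if mem: "z \<in> E" and z: "z - c = x *\<^sub>R p + y *\<^sub>R q" for x y z
  proof -
    obtain x' y' where "z = c + x' *\<^sub>R p + y' *\<^sub>R q" and 1: "x'\<^sup>2 + y'\<^sup>2 = 1"
      using mem unfolding Epq by (rule affine_circleE)
    then have "x *\<^sub>R p + y *\<^sub>R q = x' *\<^sub>R p + y' *\<^sub>R q" using z by simp
    from cross2_coordinates_unique[OF pq this] 1 show ?thesis by simp
  qed
  have K: "K = c + (o1 *\<^sub>R p + o2 *\<^sub>R q)" using o by (simp add: algebra_simps)
  have "u1\<^sup>2 + u2\<^sup>2 = 1 - (o1\<^sup>2 + o2\<^sup>2)"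
    using sub
    by (intro power_of_point_balanced_chord[OF ab(1)] unit[of "K + a *\<^sub>R u"]
        unit[of "K - (1 / a) *\<^sub>R u"]) (simp_all add: K u algebra_simps add_divide_distrib)
  moreover have "v1\<^sup>2 + v2\<^sup>2 = 1 - (o1\<^sup>2 + o2\<^sup>2)"
    using sub
    by (intro power_of_point_balanced_chord[OF ab(2)] unit[of "K + b *\<^sub>R v"]
        unit[of "K - (1 / b) *\<^sub>R v"]) (simp_all add: K v algebra_simps add_divide_distrib)
  ultimately have orth: "(u1 + v1) * (u1 - v1) + (u2 + v2) * (u2 - v2) = 0"
    by (simp add: power2_eq_square algebra_simps)
  have coords: "u + v = (u1 + v1) *\<^sub>R p + (u2 + v2) *\<^sub>R q"
    "u - v = (u1 - v1) *\<^sub>R p + (u2 - v2) *\<^sub>R q"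
    by (simp_all add: u v algebra_simps)
  have nz: "u + v \<noteq> 0" "u - v \<noteq> 0"
    using uv by (auto simp: eq_neg_iff_add_eq_0[symmetric])
  show thesis
    using affine_circle_conjugate_radii[OF pq nz coords orth] that unfolding Epq by metis
qed

text \<open>
  Converse of the intersecting chords theorem, in the chart where \<open>(u + v) / P\<close> and \<open>(u - v) / N\<close>
  are orthonormal. There \<open>u\<close> and \<open>v\<close> have the same squared length \<open>S\<close>. A circle with centre \<open>K + m\<close>
  contains both \<open>K + a u\<close> and \<open>K - (1/a) u\<close> when \<open>2 m \<bullet> u = (a - 1/a) S\<close>, its squared radius
  being \<open>S + \<bar>m\<bar>\<^sup>2\<close>; likewise for \<open>v\<close> and \<open>b\<close>. The squared radius is the same for both chords, so
  it remains to solve two linear equations for \<open>m = \<alpha> (u + v) + \<beta> (u - v)\<close>.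
\<close>

lemma equal_radii_ellipse_through_balanced_chords:
  assumes uv: "cross2 u v \<noteq> 0" and ab: "a > 0" "b > 0"
  obtains c s t where "s \<noteq> 0" "t \<noteq> 0" "norm (s *\<^sub>R (u + v)) = norm (t *\<^sub>R (u - v))"
    "{K + a *\<^sub>R u, K + b *\<^sub>R v, K - (1 / a) *\<^sub>R u, K - (1 / b) *\<^sub>R v}
       \<subseteq> affine_circle c (s *\<^sub>R (u + v)) (t *\<^sub>R (u - v))"
proof -
  define P where "P = norm (u + v)"
  define N where "N = norm (u - v)"
  have nz: "u + v \<noteq> 0" "u - v \<noteq> 0"
    using uv by (auto simp: eq_neg_iff_add_eq_0[symmetric])
  then have PN: "P > 0" "N > 0" by (simp_all add: P_def N_def)
  define S where "S = (P\<^sup>2 + N\<^sup>2) / 4"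
  have "S > 0" using PN by (simp add: S_def add_pos_pos)
  define \<alpha> where "\<alpha> = S * ((a - 1 / a) + (b - 1 / b)) / (2 * P\<^sup>2)"
  define \<beta> where "\<beta> = S * ((a - 1 / a) - (b - 1 / b)) / (2 * N\<^sup>2)"
  have \<alpha>: "\<alpha> * P\<^sup>2 = S * ((a - 1 / a) + (b - 1 / b)) / 2"
    and \<beta>: "\<beta> * N\<^sup>2 = S * ((a - 1 / a) - (b - 1 / b)) / 2"
    using PN by (simp_all add: \<alpha>_def \<beta>_def)
  define \<rho> where "\<rho> = sqrt (S + \<alpha>\<^sup>2 * P\<^sup>2 + \<beta>\<^sup>2 * N\<^sup>2)"
  have pos: "S + \<alpha>\<^sup>2 * P\<^sup>2 + \<beta>\<^sup>2 * N\<^sup>2 > 0" using \<open>S > 0\<close> by (simp add: add_pos_nonneg)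
  then have \<rho>: "\<rho> > 0" "\<rho>\<^sup>2 = S + \<alpha>\<^sup>2 * P\<^sup>2 + \<beta>\<^sup>2 * N\<^sup>2" by (simp_all add: \<rho>_def)
  define c where "c = K + \<alpha> *\<^sub>R (u + v) + \<beta> *\<^sub>R (u - v)"
  let ?E = "affine_circle c ((\<rho> / P) *\<^sub>R (u + v)) ((\<rho> / N) *\<^sub>R (u - v))"
  have mem: "K + x *\<^sub>R (u + v) + y *\<^sub>R (u - v) \<in> ?E"
    if "(x - \<alpha>)\<^sup>2 * P\<^sup>2 + (y - \<beta>)\<^sup>2 * N\<^sup>2 = \<rho>\<^sup>2" for x y
  proof (rule affine_circleI)
    show "K + x *\<^sub>R (u + v) + y *\<^sub>R (u - v) = c +
      ((x - \<alpha>) * P / \<rho>) *\<^sub>R (\<rho> / P) *\<^sub>R (u + v) + ((y - \<beta>) * N / \<rho>) *\<^sub>R (\<rho> / N) *\<^sub>R (u - v)"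
      using PN \<rho>(1) by (simp add: c_def scaleR_diff_left)
    have "((x - \<alpha>) * P / \<rho>)\<^sup>2 + ((y - \<beta>) * N / \<rho>)\<^sup>2
        = ((x - \<alpha>)\<^sup>2 * P\<^sup>2 + (y - \<beta>)\<^sup>2 * N\<^sup>2) / \<rho>\<^sup>2"
      by (simp add: power_divide power_mult_distrib add_divide_distrib)
    then show "((x - \<alpha>) * P / \<rho>)\<^sup>2 + ((y - \<beta>) * N / \<rho>)\<^sup>2 = 1"
      using that \<rho>(1) by simp
  qed
  have expand_u: "(x / 2 - \<alpha>)\<^sup>2 * P\<^sup>2 + (x / 2 - \<beta>)\<^sup>2 * N\<^sup>2
      = \<rho>\<^sup>2 + S * (x\<^sup>2 - 1) - x * (\<alpha> * P\<^sup>2 + \<beta> * N\<^sup>2)" for x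
    unfolding \<rho>(2) by (simp add: S_def power2_eq_square field_simps)
  have expand_v: "(x / 2 - \<alpha>)\<^sup>2 * P\<^sup>2 + (- x / 2 - \<beta>)\<^sup>2 * N\<^sup>2
      = \<rho>\<^sup>2 + S * (x\<^sup>2 - 1) - x * (\<alpha> * P\<^sup>2 - \<beta> * N\<^sup>2)" for x
    unfolding \<rho>(2) by (simp add: S_def power2_eq_square field_simps)
  have sum: "\<alpha> * P\<^sup>2 + \<beta> * N\<^sup>2 = S * (a - 1 / a)" and diff: "\<alpha> * P\<^sup>2 - \<beta> * N\<^sup>2 = S * (b - 1 / b)"
    unfolding \<alpha> \<beta>
    by (simp_all only: right_diff_distrib distrib_left diff_divide_distrib add_divide_distrib)
  \<comment> \<open>The roots of the quadratic equation are \<open>a\<close> and \<open>- 1 / a\<close>.\<close>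
  have on_u: "K + x *\<^sub>R u \<in> ?E" if "x\<^sup>2 - 1 = x * (a - 1 / a)" for x
  proof -
    have "K + x *\<^sub>R u = K + (x / 2) *\<^sub>R (u + v) + (x / 2) *\<^sub>R (u - v)"
      by (simp add: vec_eq_iff algebra_simps)
    moreover have "(x / 2 - \<alpha>)\<^sup>2 * P\<^sup>2 + (x / 2 - \<beta>)\<^sup>2 * N\<^sup>2 = \<rho>\<^sup>2"
      unfolding expand_u sum that by simp
    ultimately show ?thesis using mem[of "x / 2" "x / 2"] by (simp only:)
  qed
  have on_v: "K + x *\<^sub>R v \<in> ?E" if "x\<^sup>2 - 1 = x * (b - 1 / b)" for x
  proof -
    have "K + x *\<^sub>R v = K + (x / 2) *\<^sub>R (u + v) + (- x / 2) *\<^sub>R (u - v)"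
      by (simp add: vec_eq_iff algebra_simps)
    moreover have "(x / 2 - \<alpha>)\<^sup>2 * P\<^sup>2 + (- x / 2 - \<beta>)\<^sup>2 * N\<^sup>2 = \<rho>\<^sup>2"
      unfolding expand_v diff that by simp
    ultimately show ?thesis using mem[of "x / 2" "- x / 2"] by (simp only:)
  qed
  have "K + a *\<^sub>R u \<in> ?E" "K + (- (1 / a)) *\<^sub>R u \<in> ?E"
    using ab by (intro on_u; simp add: power2_eq_square field_simps)+
  moreover have "K + b *\<^sub>R v \<in> ?E" "K + (- (1 / b)) *\<^sub>R v \<in> ?E"
    using ab by (intro on_v; simp add: power2_eq_square field_simps)+
  moreover have "norm ((\<rho> / P) *\<^sub>R (u + v)) = norm ((\<rho> / N) *\<^sub>R (u - v))"
    using PN by (simp flip: P_def N_def)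
  ultimately show thesis
    using that[of "\<rho> / P" "\<rho> / N" c] PN \<rho>(1) by simp
qed

section \<open>Equal conjugate diameters in the common directions\<close>

theorem proposition2:
  fixes A B C D :: "real^2" and M1 M2 :: ereal
  assumes "convex_quadrilateral A B C D"
    and "\<not> trapezoid A B C D"
    and "unique_common_conjugate_directions {A, B, C, D} M1 M2"
  shows "\<exists>E p q r s. is_ellipse E \<and> {A, B, C, D} \<subseteq> E \<and>
           equal_conjugate_diameters E p q r s \<and>
           directional_constant p q M1 \<and> directional_constant r s M2"
proof -
  obtain K u v a b where uv: "cross2 u v \<noteq> 0" and ab: "a > 0" "b > 0"
    and ABCD: "A = K + a *\<^sub>R u" "C = K - (1 / a) *\<^sub>R u" "B = K + b *\<^sub>R v" "D = K - (1 / b) *\<^sub>R v"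
    using assms(1) by (rule convex_quadrilateral_diagonals)
  have indep: "cross2 (s *\<^sub>R (u + v)) (t *\<^sub>R (u - v)) \<noteq> 0" if "s \<noteq> 0" "t \<noteq> 0" for s t
    using that uv by (simp add: cross2_commute[of v u])
  have nz: "u + v \<noteq> 0" "u - v \<noteq> 0"
    using cross2_nonzero_vectors[OF indep[of 1 1]] by auto
  obtain N1 where N1: "\<And>c k. k \<noteq> 0 \<Longrightarrow>
      directional_constant (c - k *\<^sub>R (u + v)) (c + k *\<^sub>R (u + v)) N1"
    using directional_constant_exists[OF nz(1)] by blast
  obtain N2 where N2: "\<And>c k. k \<noteq> 0 \<Longrightarrow>
      directional_constant (c - k *\<^sub>R (u - v)) (c + k *\<^sub>R (u - v)) N2"
    using directional_constant_exists[OF nz(2)] by blast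
  have "common_conjugate_directions {A, B, C, D} N1 N2"
    unfolding common_conjugate_directions_def
  proof (intro allI impI)
    fix E assume "is_ellipse E \<and> {A, B, C, D} \<subseteq> E"
    then obtain c s t where st: "s \<noteq> 0" "t \<noteq> 0"
      and E: "E = affine_circle c (s *\<^sub>R (u + v)) (t *\<^sub>R (u - v))"
      using ellipse_through_balanced_chords[OF _ uv ab] unfolding ABCD by metis
    show "conjugate_directions E N1 N2"
      unfolding conjugate_directions_def E
      using conjugate_diameters_affine_circle[OF indep[OF st]] N1[OF st(1)] N2[OF st(2)] by blast
  qed
  then have "{N1, N2} = {M1, M2}"
    using assms(3) unfolding unique_common_conjugate_directions_def by blast
  \<comment> \<open>Only the unordered pair is determined, so the two diameters may have to be exchanged.\<close>
  then have M: "M1 = N1 \<and> M2 = N2 \<or> M1 = N2 \<and> M2 = N1"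
    by (auto simp: doubleton_eq_iff)
  obtain c s t where st: "s \<noteq> 0" "t \<noteq> 0"
    and len: "norm (s *\<^sub>R (u + v)) = norm (t *\<^sub>R (u - v))"
    and sub: "{A, B, C, D} \<subseteq> affine_circle c (s *\<^sub>R (u + v)) (t *\<^sub>R (u - v))"
    using equal_radii_ellipse_through_balanced_chords[OF uv ab, of K] unfolding ABCD by metis
  let ?p = "s *\<^sub>R (u + v)" and ?q = "t *\<^sub>R (u - v)"
  let ?E = "affine_circle c ?p ?q"
  have ell: "is_ellipse ?E"
    using ellipse_with_center_affine_circle[OF indep[OF st]] by (auto simp: is_ellipse_def)
  have length: "dist (c - w) (c + w) = 2 * norm w" for w :: "real^2"
  proof -
    have "(c - w) - (c + w) = (- 2) *\<^sub>R w" by (simp add: vec_eq_iff)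
    then show ?thesis unfolding dist_norm by simp
  qed
  have "equal_conjugate_diameters ?E (c - ?p) (c + ?p) (c - ?q) (c + ?q)"
    using conjugate_diameters_affine_circle[OF indep[OF st]]
    unfolding equal_conjugate_diameters_def length len by blast
  moreover from this have "equal_conjugate_diameters ?E (c - ?q) (c + ?q) (c - ?p) (c + ?p)"
    using conjugate_diameters_commute unfolding equal_conjugate_diameters_def by metis
  ultimately show ?thesis
    using M ell sub N1[OF st(1), of c] N2[OF st(2), of c] by blast
qed

end
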